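(* If $D$ is a digraph with $n$ vertices, then $D$ has a subtree representation in a star with at most $n$ leaves.
   Context: A digraph $D$ is finite with nonempty vertex set $V(D)$; loops are allowed, no multiple edges. A star with $m$ leaves is the tree $K_{1,m}$, consisting of a center adjacent to $m$ other vertices (its leaves; the center is not counted as a leaf). Subtrees are nonempty connected subgraphs. A subtree representation of $D$ in a host tree $T$ assigns to each vertex $v$ an ordered pair $(S_v,T_v)$ of subtrees of $T$ such that $uv$ is an edge of $D$ if and only if $S_u$ and $T_v$ have a common vertex (for all $u,v\in V(D)$, including $u=v$). *)

theory Defs
  imports "Graph_Theory.Graph_Theory"
begin

text \<open>
  Undirected graphs are symmetric digraphs, as in the library. Requiring
  \<^const>\<open>graph\<close> of \<open>H\<close> makes it a subgraph in the undirected sense: it contains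
  both or neither of the two orientations of an edge of \<open>T\<close>. The constant
  \<^const>\<open>connected\<close> of the graph library includes nonemptiness.
\<close>

definition subtree :: "('v, 'e) pre_digraph \<Rightarrow> ('v, 'e) pre_digraph \<Rightarrow> bool" where
  "subtree H T \<longleftrightarrow> graph H \<and> subgraph H T \<and> Digraph_Component.connected H"

text \<open>
  The pair \<open>R v\<close> is \<open>(S\<^sub>v, T\<^sub>v)\<close>. The host \<open>T\<close> is meant to be a tree; this is
  not part of the definition and has to be ensured where it is used.
\<close>

definition subtree_representation ::
  "('a, 'b) pre_digraph \<Rightarrow> ('v, 'e) pre_digraph \<Rightarrow>
    ('a \<Rightarrow> ('v, 'e) pre_digraph \<times> ('v, 'e) pre_digraph) \<Rightarrow> bool" where
  "subtree_representation D T R \<longleftrightarrow>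
     (\<forall>v \<in> verts D. subtree (fst (R v)) T \<and> subtree (snd (R v)) T) \<and>
     (\<forall>u \<in> verts D. \<forall>v \<in> verts D.
        u \<rightarrow>\<^bsub>D\<^esub> v \<longleftrightarrow> verts (fst (R u)) \<inter> verts (snd (R v)) \<noteq> {})"

end

(* Give every vertex v its own leaf. Let T_v be that leaf alone, and let S_u be the
   substar on the centre and the leaves of the out-neighbours of u. The centre makes S_u
   connected (and nonempty when u has no out-neighbour), and it lies in no T_v. *)
theory Submission
  imports Defs
begin

text \<open>Both orientations of an edge are arcs, because undirected graphs are symmetric digraphs
  here. With \<open>L = {}\<close> this is a single vertex, so one-vertex trees are covered
  too.\<close>

definition star :: "'v \<Rightarrow> 'v set \<Rightarrow> 'v pair_pre_digraph" where
  "star c L = \<lparr> pverts = insert c L, parcs = {c} \<times> L \<union> L \<times> {c} \<rparr>"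

lemma star_simps [simp]:
  "pverts (star c L) = insert c L"
  "parcs (star c L) = {c} \<times> L \<union> L \<times> {c}"
  by (simp_all add: star_def)

text \<open>The parts are \<open>{c}\<close> and \<open>L\<close>. Besides describing the host, this
  supplies the graph axioms, which the library builds into its complete bipartite graphs.\<close>

lemma complete_bipartite_star:
  assumes "finite L" "c \<notin> L"
  shows "K\<^bsub>1,card L\<^esub> (with_proj (star c L))"
  unfolding complete_bipartite_digraph_pair_def
  using assms by (intro conjI exI[of _ "{c}"] exI[of _ L]) auto

lemma graph_star:
  assumes "finite L" "c \<notin> L"
  shows "graph (with_proj (star c L))"
  using complete_bipartite_star[OF assms] by (simp add: complete_bipartite_digraph_def)

lemma connected_star:
  assumes "finite L" "c \<notin> L"
  shows "Digraph_Component.connected (with_proj (star c L))"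
proof -
  interpret graph "with_proj (star c L)"
    using assms by (rule graph_star)
  have to_centre: "u \<rightarrow>\<^sup>*\<^bsub>with_proj (star c L)\<^esub> c" if "u \<in> insert c L" for u
    using that by (cases "u = c") auto
  have "u \<rightarrow>\<^sup>*\<^bsub>with_proj (star c L)\<^esub> v" if "u \<in> insert c L" "v \<in> insert c L" for u v
    using to_centre[OF that(1)] symmetric_reachable'[OF to_centre[OF that(2)]]
    by (rule reachable_trans)
  then show ?thesis
    \<comment> \<open>Connectedness speaks of the symmetric closure; the arcs being symmetric
      already, reachability there is the same.\<close>
    by (intro connectedI) (simp_all add: reachable_mk_symmetric_eq[OF sym_arcs])
qed

text \<open>The centres may differ: a single leaf of the host is a star centred at that
  leaf.\<close>

lemma subtree_star:
  assumes "finite L" "c \<notin> L" "finite L'" "c' \<notin> L'"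
    and "insert c' L' \<subseteq> insert c L" "parcs (star c' L') \<subseteq> parcs (star c L)"
  shows "subtree (with_proj (star c' L')) (with_proj (star c L))"
proof -
  interpret G: graph "with_proj (star c L)"
    using assms(1,2) by (rule graph_star)
  interpret H: graph "with_proj (star c' L')"
    using assms(3,4) by (rule graph_star)
  show ?thesis
    using assms G.wf_digraph H.wf_digraph H.graph_axioms
    by (simp add: subtree_def subgraph_def compatibleI_with_proj connected_star)
qed

theorem theorem1:
  fixes D :: "('a, 'b) pre_digraph" and n :: nat
  assumes "fin_digraph D" and "nomulti_digraph D" and "verts D \<noteq> {}"
    and "card (verts D) = n"
  shows "\<exists>m \<le> n. \<exists>T :: (nat, nat \<times> nat) pre_digraph.
    K\<^bsub>1,m\<^esub> T \<and> (\<exists>R. subtree_representation D T R)"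
proof -
  interpret D: fin_digraph D by fact
  obtain f where f: "bij_betw f (verts D) {0..<n}"
    using ex_bij_betw_finite_nat[OF D.finite_verts] assms(4) by blast
  \<comment> \<open>The labels \<open>0..<n\<close> are the leaves, one for each vertex of
    \<open>D\<close>, and \<open>n\<close> is a fresh label for the centre.\<close>
  define T where "T = with_proj (star n {0..<n})"
  define S where "S u = star n (f ` {v \<in> verts D. u \<rightarrow>\<^bsub>D\<^esub> v})" for u
  define R where "R v = (with_proj (S v), with_proj (star (f v) {}))" for v
  have f_less: "f v < n" if "v \<in> verts D" for v
    using bij_betwE[OF f] that by auto
  have f_inj: "f v = f w \<longleftrightarrow> v = w" if "v \<in> verts D" "w \<in> verts D" for v w
    using bij_betw_imp_inj_on[OF f] that by (auto dest: inj_onD)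
  have "subtree (with_proj (S u)) T" for u
    unfolding S_def T_def by (rule subtree_star) (auto dest: f_less)
  moreover have "subtree (with_proj (star (f v) {})) T" if "v \<in> verts D" for v
    unfolding T_def using f_less[OF that] by (intro subtree_star) auto
  \<comment> \<open>Since \<open>f v < n\<close>, the vertex \<open>f v\<close> is not the centre of
    \<open>S u\<close>; by injectivity of \<open>f\<close> it is a leaf of \<open>S u\<close> only
    if \<open>v\<close> itself is an out-neighbour of \<open>u\<close>. Loops need no separate
    case.\<close>
  moreover have "u \<rightarrow>\<^bsub>D\<^esub> v \<longleftrightarrow> pverts (S u) \<inter> pverts (star (f v) {}) \<noteq> {}"
    if "v \<in> verts D" for u v
    using that f_less[OF that] by (auto simp: S_def f_inj)
  ultimately have "subtree_representation D T R"
    by (simp add: subtree_representation_def R_def)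
  moreover have "K\<^bsub>1,n\<^esub> T"
    using complete_bipartite_star[of "{0..<n}" n] by (simp add: T_def)
  ultimately show ?thesis by blast
qed

end
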